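(* Let $G$ be a three-dimensional Lie group with a bi-invariant metric $\langle\,,\rangle$ and Lie algebra $\mathfrak{g}$. Let $\alpha:I\subset\mathbb{R}\to G$ be an arc-length parametrized regular curve with Frenet frame $\{T,N,B\}$, and let $\delta$ be the binormal indicatrix of $\alpha$, a curve on the unit sphere $S^2\subset\mathfrak{g}$. Then $\alpha$ is a slant helix in $G$ if and only if $\delta$ is a general helix on $S^2$.
   Context: $\mathfrak{g}$ is the Lie algebra of left-invariant vector fields of $G$ and $D$ is the Levi-Civita connection, so $D_XY=\frac12[X,Y]$ for $X,Y\in\mathfrak{g}$. Let $\{X_1,X_2,X_3\}$ be an orthonormal basis of $\mathfrak{g}$. Vector fields along $\alpha$ are written $W=\sum_i w_iX_i$ with smooth $w_i:I\to\mathbb{R}$; one sets $\dot W=\sum_i w_i'X_i$, brackets are extended bilinearly over functions, and $D_{\alpha'}W=\dot W+\frac12[T,W]$ with $T=\alpha'$. The Frenet apparatus of a unit speed curve consists of the positively oriented orthonormal frame $T=\alpha',N,B=T\times N$, the curvature $\varkappa=\|\dot T\|>0$ and the torsion $\tau$, with $D_TT=\varkappa N$, $D_TN=-\varkappa T+\tau B$, $D_TB=-\tau N$. Slant helix: $\alpha$ is a slant helix if there is a unit length left-invariant vector field $X\in\mathfrak{g}$ and a constant angle $\theta\ne\frac{\pi}{2}$ such that $\langle N(s),X\rangle=\cos\theta$ for all $s\in I$. Binormal indicatrix: writing $B(s)=\sum_{i=1}^3b_i(s)X_i$, it is the parametrized curve $\delta$ in $S^2\subset\mathfrak{g}$ given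 by $\delta(s^* )=B(s)=\sum_{i=1}^3b_i(s)X_i$, where $s^*$ is the arc length parameter of $\delta$ (so $\delta$ is a regular curve). General helix: a curve whose unit tangent makes a constant angle with a left-invariant vector field, i.e. there are a unit length $X\in\mathfrak{g}$ and a constant $\theta$ with $\langle \text{unit tangent},X\rangle=\cos\theta$ along the curve; for the curve $\delta$ in the Euclidean space $\mathfrak{g}$ this means $\langle T_\delta(s^* ),X\rangle=\cos\theta$ for all $s^*$, where $T_\delta=d\delta/ds^*$.
   Formalization: Angles lie in [0,π], and the right angle θ=π/2 is excluded for the general helix δ as well as for the slant helix α; otherwise the "if" direction fails, e.g. for a circular helix in ℝ³. *)

theory Defs
  imports "HOL-Analysis.Analysis"
begin

text \<open>
  Smoothness on a set. Derivatives are taken within \<open>S\<close>; they are unique for the two kinds of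
  sets used below, namely open sets and relatively open subsets of nondegenerate real intervals.
\<close>

primrec Ck_on :: "nat \<Rightarrow> 'a::euclidean_space set \<Rightarrow> ('a \<Rightarrow> 'b::real_normed_vector) \<Rightarrow> bool" where
  "Ck_on 0 S f \<longleftrightarrow> continuous_on S f"
| "Ck_on (Suc k) S f \<longleftrightarrow> f differentiable_on S \<and>
     (\<forall>v. Ck_on k S (\<lambda>x. frechet_derivative f (at x within S) v))"

definition smooth_on :: "'a::euclidean_space set \<Rightarrow> ('a \<Rightarrow> 'b::real_normed_vector) \<Rightarrow> bool" where
  "smooth_on S f \<longleftrightarrow> (\<forall>k. Ck_on k S f)"


section \<open>Three-dimensional Lie groups\<close>

text \<open>
  The group is a type; its (in general noncommutative) operation is written additively because
  that is the notation of the library classes \<^class>\<open>group_add\<close> and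
  \<^class>\<open>topological_group_add\<close>. The neutral element is \<open>0\<close>. The smooth structure is given by an
  atlas, a set of pairs of a chart domain and a chart.
\<close>

type_synonym 'g atlas = "('g set \<times> ('g \<Rightarrow> real^3)) set"

definition smooth_atlas :: "'g::topological_space atlas \<Rightarrow> bool" where
  "smooth_atlas A \<longleftrightarrow>
     (\<forall>(U, \<phi>) \<in> A. open U \<and> open (\<phi> ` U) \<and> homeomorphism U (\<phi> ` U) \<phi> (inv_into U \<phi>)) \<and>
     (\<Union>(U, \<phi>) \<in> A. U) = UNIV \<and>
     (\<forall>(U, \<phi>) \<in> A. \<forall>(V, \<psi>) \<in> A. smooth_on (\<phi> ` (U \<inter> V)) (\<psi> \<circ> inv_into U \<phi>))"

definition lie_group_3 ::
    "'g::{topological_group_add, t2_space, second_countable_topology} atlas \<Rightarrow> bool" where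
  "lie_group_3 A \<longleftrightarrow> smooth_atlas A \<and>
     (\<forall>(U, \<phi>) \<in> A. \<forall>(V, \<psi>) \<in> A. \<forall>(W, \<rho>) \<in> A.
        smooth_on {(x, y). x \<in> \<phi> ` U \<and> y \<in> \<psi> ` V \<and> inv_into U \<phi> x + inv_into V \<psi> y \<in> W}
          (\<lambda>(x, y). \<rho> (inv_into U \<phi> x + inv_into V \<psi> y))) \<and>
     (\<forall>(U, \<phi>) \<in> A. \<forall>(V, \<psi>) \<in> A.
        smooth_on {x \<in> \<phi> ` U. - inv_into U \<phi> x \<in> V} (\<lambda>x. \<psi> (- inv_into U \<phi> x)))"

definition smooth_fun :: "'g atlas \<Rightarrow> ('g \<Rightarrow> real) \<Rightarrow> bool" where
  "smooth_fun A f \<longleftrightarrow> (\<forall>(U, \<phi>) \<in> A. smooth_on (\<phi> ` U) (f \<circ> inv_into U \<phi>))"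

definition smooth_curve :: "'g::topological_space atlas \<Rightarrow> real set \<Rightarrow> (real \<Rightarrow> 'g) \<Rightarrow> bool" where
  "smooth_curve A I \<alpha> \<longleftrightarrow> continuous_on I \<alpha> \<and>
     (\<forall>(U, \<phi>) \<in> A. smooth_on {s \<in> I. \<alpha> s \<in> U} (\<phi> \<circ> \<alpha>))"

text \<open>
  Tangent vectors at \<open>p\<close> are the derivations at \<open>p\<close> of the algebra of smooth functions. As HOL
  functions are total, a tangent vector takes the dummy value \<open>0\<close> on functions that are not
  smooth, so that equality of tangent vectors is equality in HOL.
\<close>

type_synonym 'g tvec = "('g \<Rightarrow> real) \<Rightarrow> real"
type_synonym 'g vfield = "'g \<Rightarrow> 'g tvec"

definition tangent_space :: "'g atlas \<Rightarrow> 'g \<Rightarrow> 'g tvec set" where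
  "tangent_space A p = {v.
     (\<forall>f h a b. smooth_fun A f \<longrightarrow> smooth_fun A h \<longrightarrow>
        v (\<lambda>x. a * f x + b * h x) = a * v f + b * v h) \<and>
     (\<forall>f h. smooth_fun A f \<longrightarrow> smooth_fun A h \<longrightarrow>
        v (\<lambda>x. f x * h x) = v f * h p + f p * v h) \<and>
     (\<forall>f. \<not> smooth_fun A f \<longrightarrow> v f = 0)}"

definition velocity :: "'g atlas \<Rightarrow> real set \<Rightarrow> (real \<Rightarrow> 'g) \<Rightarrow> real \<Rightarrow> 'g tvec" where
  "velocity A I \<alpha> s =
     (\<lambda>f. if smooth_fun A f then vector_derivative (f \<circ> \<alpha>) (at s within I) else 0)"

definition pushforward :: "('g \<Rightarrow> 'g) \<Rightarrow> 'g tvec \<Rightarrow> 'g tvec" where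
  "pushforward F v = (\<lambda>f. v (f \<circ> F))"

definition smooth_vfield :: "'g atlas \<Rightarrow> 'g vfield \<Rightarrow> bool" where
  "smooth_vfield A Y \<longleftrightarrow> (\<forall>p. Y p \<in> tangent_space A p) \<and>
     (\<forall>f. smooth_fun A f \<longrightarrow> smooth_fun A (\<lambda>p. Y p f))"

definition lie_algebra :: "'g::group_add atlas \<Rightarrow> 'g vfield set" where
  "lie_algebra A =
     {Y. smooth_vfield A Y \<and> (\<forall>a p. Y (a + p) = pushforward (\<lambda>x. a + x) (Y p))}"

definition lie_bracket :: "'g vfield \<Rightarrow> 'g vfield \<Rightarrow> 'g vfield" where
  "lie_bracket Y Z = (\<lambda>p f. Y p (\<lambda>q. Z q f) - Z p (\<lambda>q. Y q f))"


section \<open>Bi-invariant metrics\<close>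

definition inner_product_on :: "'g tvec set \<Rightarrow> ('g tvec \<Rightarrow> 'g tvec \<Rightarrow> real) \<Rightarrow> bool" where
  "inner_product_on V b \<longleftrightarrow>
     (\<forall>u\<in>V. \<forall>v\<in>V. \<forall>w\<in>V. \<forall>x y. b (\<lambda>f. x * u f + y * v f) w = x * b u w + y * b v w) \<and>
     (\<forall>u\<in>V. \<forall>v\<in>V. b u v = b v u) \<and>
     (\<forall>v\<in>V. v \<noteq> (\<lambda>f. 0) \<longrightarrow> 0 < b v v)"

type_synonym 'g metric = "'g \<Rightarrow> 'g tvec \<Rightarrow> 'g tvec \<Rightarrow> real"

definition riemannian_metric :: "'g atlas \<Rightarrow> 'g metric \<Rightarrow> bool" where
  "riemannian_metric A m \<longleftrightarrow>
     (\<forall>p. inner_product_on (tangent_space A p) (m p)) \<and>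
     (\<forall>Y Z. smooth_vfield A Y \<longrightarrow> smooth_vfield A Z \<longrightarrow> smooth_fun A (\<lambda>p. m p (Y p) (Z p)))"

definition bi_invariant_metric :: "'g::group_add atlas \<Rightarrow> 'g metric \<Rightarrow> bool" where
  "bi_invariant_metric A m \<longleftrightarrow> riemannian_metric A m \<and>
     (\<forall>a p. \<forall>u \<in> tangent_space A p. \<forall>v \<in> tangent_space A p.
        m (a + p) (pushforward (\<lambda>x. a + x) u) (pushforward (\<lambda>x. a + x) v) = m p u v \<and>
        m (p + a) (pushforward (\<lambda>x. x + a) u) (pushforward (\<lambda>x. x + a) v) = m p u v)"

text \<open>
  For left-invariant fields and a left-invariant metric the function \<open>m p (Y p) (Z p)\<close> does not
  depend on \<open>p\<close>; its value is read off at the neutral element.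
\<close>

definition linner :: "'g::group_add metric \<Rightarrow> 'g vfield \<Rightarrow> 'g vfield \<Rightarrow> real" where
  "linner m Y Z = m 0 (Y 0) (Z 0)"

definition lnorm :: "'g::group_add metric \<Rightarrow> 'g vfield \<Rightarrow> real" where
  "lnorm m Y = sqrt (linner m Y Y)"

definition lin_comb :: "(3 \<Rightarrow> 'g vfield) \<Rightarrow> real^3 \<Rightarrow> 'g vfield" where
  "lin_comb X w = (\<lambda>p f. \<Sum>i\<in>UNIV. w $ i * X i p f)"

definition orthonormal_basis ::
    "'g::group_add atlas \<Rightarrow> 'g metric \<Rightarrow> (3 \<Rightarrow> 'g vfield) \<Rightarrow> bool" where
  "orthonormal_basis A m X \<longleftrightarrow>
     (\<forall>i. X i \<in> lie_algebra A) \<and>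
     (\<forall>i j. linner m (X i) (X j) = (if i = j then 1 else 0)) \<and>
     (\<forall>Y \<in> lie_algebra A. \<exists>w. Y = lin_comb X w)"

definition coords :: "'g::group_add metric \<Rightarrow> (3 \<Rightarrow> 'g vfield) \<Rightarrow> 'g vfield \<Rightarrow> real^3" where
  "coords m X Y = (\<chi> i. linner m Y (X i))"


section \<open>Vector fields along a curve\<close>

text \<open>
  A vector field \<open>W = (\<Sum>i. w\<^sub>i X\<^sub>i)\<close> along \<open>\<alpha>\<close> is represented by the map sending \<open>s\<close> to the element
  \<open>\<Sum>i. w\<^sub>i(s) X\<^sub>i\<close> of the Lie algebra; the actual tangent vector at \<open>\<alpha> s\<close> is \<open>W s (\<alpha> s)\<close>.
  With this representation the bilinear extension of the bracket to fields along \<open>\<alpha>\<close> is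
  \<open>lie_bracket (V s) (W s)\<close>. Curves in the Lie algebra are objects of the same kind.
\<close>

definition smooth_field_on ::
    "'g::group_add atlas \<Rightarrow> 'g metric \<Rightarrow> (3 \<Rightarrow> 'g vfield) \<Rightarrow> real set \<Rightarrow> (real \<Rightarrow> 'g vfield) \<Rightarrow> bool" where
  "smooth_field_on A m X I W \<longleftrightarrow>
     (\<forall>s\<in>I. W s \<in> lie_algebra A) \<and> smooth_on I (\<lambda>s. coords m X (W s))"

definition dot_field ::
    "'g::group_add metric \<Rightarrow> (3 \<Rightarrow> 'g vfield) \<Rightarrow> real set \<Rightarrow> (real \<Rightarrow> 'g vfield) \<Rightarrow> real \<Rightarrow> 'g vfield" where
  "dot_field m X I W s =
     lin_comb X (vector_derivative (\<lambda>t. coords m X (W t)) (at s within I))"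

text \<open>
  The Levi-Civita connection of a bi-invariant metric satisfies \<open>D\<^sub>Y Z = [Y, Z] / 2\<close> for
  left-invariant \<open>Y\<close>, \<open>Z\<close>; hence \<open>D\<^sub>T W\<close> is \<open>dot W + [T, W] / 2\<close> for \<open>T = \<alpha>'\<close>.
\<close>

definition cov_deriv ::
    "'g::group_add metric \<Rightarrow> (3 \<Rightarrow> 'g vfield) \<Rightarrow> real set \<Rightarrow> (real \<Rightarrow> 'g vfield) \<Rightarrow> (real \<Rightarrow> 'g vfield)
      \<Rightarrow> real \<Rightarrow> 'g vfield" where
  "cov_deriv m X I T W s =
     (\<lambda>p f. dot_field m X I W s p f + 1/2 * lie_bracket (T s) (W s) p f)"

text \<open>The cross product for the orientation in which the orthonormal basis \<open>X\<close> is positive.\<close>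

definition cross_field ::
    "'g::group_add metric \<Rightarrow> (3 \<Rightarrow> 'g vfield) \<Rightarrow> 'g vfield \<Rightarrow> 'g vfield \<Rightarrow> 'g vfield" where
  "cross_field m X Y Z = lin_comb X (cross3 (coords m X Y) (coords m X Z))"

definition unit_speed_curve ::
    "'g::topological_space atlas \<Rightarrow> 'g metric \<Rightarrow> real set \<Rightarrow> (real \<Rightarrow> 'g) \<Rightarrow> bool" where
  "unit_speed_curve A m I \<alpha> \<longleftrightarrow> is_interval I \<and> interior I \<noteq> {} \<and> smooth_curve A I \<alpha> \<and>
     (\<forall>s\<in>I. m (\<alpha> s) (velocity A I \<alpha> s) (velocity A I \<alpha> s) = 1)"

definition frenet_apparatus ::
    "'g::group_add atlas \<Rightarrow> 'g metric \<Rightarrow> (3 \<Rightarrow> 'g vfield) \<Rightarrow> real set \<Rightarrow> (real \<Rightarrow> 'g) \<Rightarrow>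
     (real \<Rightarrow> 'g vfield) \<Rightarrow> (real \<Rightarrow> 'g vfield) \<Rightarrow> (real \<Rightarrow> 'g vfield) \<Rightarrow>
     (real \<Rightarrow> real) \<Rightarrow> (real \<Rightarrow> real) \<Rightarrow> bool" where
  "frenet_apparatus A m X I \<alpha> T N B \<kappa> \<tau> \<longleftrightarrow>
     smooth_field_on A m X I T \<and> smooth_field_on A m X I N \<and> smooth_field_on A m X I B \<and>
     (\<forall>s\<in>I.
        T s (\<alpha> s) = velocity A I \<alpha> s \<and>
        lnorm m (T s) = 1 \<and> lnorm m (N s) = 1 \<and> linner m (T s) (N s) = 0 \<and>
        B s = cross_field m X (T s) (N s) \<and>
        \<kappa> s = lnorm m (dot_field m X I T s) \<and> 0 < \<kappa> s \<and>
        cov_deriv m X I T T s = (\<lambda>p f. \<kappa> s * N s p f) \<and>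
        cov_deriv m X I T N s = (\<lambda>p f. - \<kappa> s * T s p f + \<tau> s * B s p f) \<and>
        cov_deriv m X I T B s = (\<lambda>p f. - \<tau> s * N s p f))"


section \<open>Binormal indicatrix and helices\<close>

text \<open>
  \<open>\<sigma> s\<close> is the arc length parameter \<open>s\<^sup>*\<close> of the regular curve \<open>B\<close>, determined up to an additive
  constant by its derivative; the indicatrix \<open>\<delta>\<close> is then a curve on the interval \<open>\<sigma> ` I\<close>.
\<close>

definition binormal_indicatrix ::
    "'g::group_add metric \<Rightarrow> (3 \<Rightarrow> 'g vfield) \<Rightarrow> real set \<Rightarrow> (real \<Rightarrow> 'g vfield) \<Rightarrow>
     (real \<Rightarrow> real) \<Rightarrow> (real \<Rightarrow> 'g vfield) \<Rightarrow> bool" where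
  "binormal_indicatrix m X I B \<sigma> \<delta> \<longleftrightarrow>
     (\<forall>s\<in>I. 0 < lnorm m (dot_field m X I B s) \<and>
        (\<sigma> has_real_derivative lnorm m (dot_field m X I B s)) (at s within I) \<and>
        \<delta> (\<sigma> s) = B s)"

text \<open>
  A unit field \<open>V\<close> with values in the Lie algebra makes a constant angle with some unit
  left-invariant field. Angles lie in \<open>[0, \<pi>]\<close>, otherwise \<open>\<theta> \<noteq> \<pi>/2\<close> would not exclude
  \<open>cos \<theta> = 0\<close>. The right angle is excluded for slant helices and for general helices alike:
  with different conventions for the two notions the equivalence fails, for example for a circular
  helix in \<open>\<real>\<^sup>3\<close>, whose principal normal is orthogonal to the axis and makes a constant angle
  with no other direction.
\<close>

definition constant_angle ::
    "'g::group_add atlas \<Rightarrow> 'g metric \<Rightarrow> real set \<Rightarrow> (real \<Rightarrow> 'g vfield) \<Rightarrow> bool" where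
  "constant_angle A m S V \<longleftrightarrow>
     (\<exists>Y \<in> lie_algebra A. lnorm m Y = 1 \<and>
        (\<exists>\<theta>\<in>{0..pi}. \<theta> \<noteq> pi/2 \<and> (\<forall>s\<in>S. linner m (V s) Y = cos \<theta>)))"

definition slant_helix ::
    "'g::group_add atlas \<Rightarrow> 'g metric \<Rightarrow> real set \<Rightarrow> (real \<Rightarrow> 'g vfield) \<Rightarrow> bool" where
  "slant_helix A m I N \<longleftrightarrow> constant_angle A m I N"

text \<open>The curve \<open>\<delta>\<close> in the Lie algebra is assumed to be parametrized by arc length on \<open>J\<close>.\<close>

definition general_helix ::
    "'g::group_add atlas \<Rightarrow> 'g metric \<Rightarrow> (3 \<Rightarrow> 'g vfield) \<Rightarrow> real set \<Rightarrow> (real \<Rightarrow> 'g vfield) \<Rightarrow> bool" where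
  "general_helix A m X J \<delta> \<longleftrightarrow> constant_angle A m J (dot_field m X J \<delta>)"

end

theory Submission
  imports Defs
begin

text \<open>
  In coordinates with respect to the orthonormal basis, all fields along \<open>\<alpha>\<close> become curves
  \<open>t\<close>, \<open>n\<close>, \<open>b\<close> in Euclidean space. The bracket \<open>[T, T]\<close> vanishes, so the first Frenet equation is
  the Euclidean one, \<open>t' = \<kappa> n\<close>. Differentiating \<open>b \<bullet> b = 1\<close> and \<open>b \<bullet> t = 0\<close> then shows that \<open>b'\<close>
  is orthogonal to \<open>b\<close> and \<open>t\<close>, hence \<open>b' = \<mu> n\<close> with \<open>\<mu> = b' \<bullet> n\<close>
  (\<open>binormal_derivative_parallel\<close>). If \<open>c\<close> is the constant with \<open>[Y, Z] = c Y \<times> Z\<close>, then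
  \<open>\<mu> = c/2 - \<tau>\<close>, but only the direction of \<open>b'\<close> matters for the angles.

  The function \<open>\<mu>\<close> is continuous, and it has no zero because \<open>\<delta>\<close> is regular; so its sign is a
  constant \<open>\<epsilon>\<close> on the interval \<open>I\<close>. As the speed of \<open>b\<close> is \<open>\<bar>\<mu>\<bar>\<close>, the unit tangent of the
  indicatrix at \<open>\<sigma> s\<close> is \<open>b' / \<bar>\<mu>\<bar> = \<epsilon> n\<close> (\<open>indicatrix_tangent\<close>). The unit tangent of \<open>\<delta>\<close> and the
  principal normal of \<open>\<alpha>\<close> therefore agree up to one global sign, and a constant angle \<open>\<theta>\<close> of one of
  them is a constant angle \<open>\<theta>\<close> or \<open>\<pi> - \<theta>\<close> of the other.
\<close>

section \<open>Coordinates in the Lie algebra\<close>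

lemma tangent_space_zero: "(\<lambda>f. 0) \<in> tangent_space A p"
  by (simp add: tangent_space_def)

lemma tangent_space_lincomb:
  assumes "u \<in> tangent_space A p" "v \<in> tangent_space A p"
  shows "(\<lambda>f. x * u f + y * v f) \<in> tangent_space A p"
proof -
  have add: "w (\<lambda>z. a * f z + b * h z) = a * w f + b * w h"
    and mult: "w (\<lambda>z. f z * h z) = w f * h p + f p * w h"
    if "w \<in> tangent_space A p" "smooth_fun A f" "smooth_fun A h" for w f h a b
    using that unfolding tangent_space_def by blast+
  have zero: "w f = 0" if "w \<in> tangent_space A p" "\<not> smooth_fun A f" for w f
    using that unfolding tangent_space_def by blast
  show ?thesis
    unfolding tangent_space_def mem_Collect_eq
  proof (intro conjI allI impI)
    fix f h :: "'a \<Rightarrow> real" and a b assume fh: "smooth_fun A f" "smooth_fun A h"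
    show "x * u (\<lambda>z. a * f z + b * h z) + y * v (\<lambda>z. a * f z + b * h z)
        = a * (x * u f + y * v f) + b * (x * u h + y * v h)"
      unfolding add[OF assms(1) fh] add[OF assms(2) fh] by algebra
    show "x * u (\<lambda>z. f z * h z) + y * v (\<lambda>z. f z * h z)
        = (x * u f + y * v f) * h p + f p * (x * u h + y * v h)"
      unfolding mult[OF assms(1) fh] mult[OF assms(2) fh] by algebra
  qed (simp add: zero[OF assms(1)] zero[OF assms(2)])
qed

lemma tangent_space_sum:
  assumes "finite S" "\<And>i. i \<in> S \<Longrightarrow> v i \<in> tangent_space A p"
  shows "(\<lambda>f. \<Sum>i\<in>S. c i * v i f) \<in> tangent_space A p"
  using assms
proof (induction S)
  case empty
  then show ?case by (simp add: tangent_space_zero)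
next
  case (insert j S)
  then have "(\<lambda>f. c j * v j f + 1 * (\<Sum>i\<in>S. c i * v i f)) \<in> tangent_space A p"
    by (intro tangent_space_lincomb) auto
  with insert show ?case by simp
qed

lemma inner_product_on_sum_left:
  assumes ip: "inner_product_on (tangent_space A p) q" and "finite S"
    and v: "\<And>i. i \<in> S \<Longrightarrow> v i \<in> tangent_space A p" and w: "w \<in> tangent_space A p"
  shows "q (\<lambda>f. \<Sum>i\<in>S. c i * v i f) w = (\<Sum>i\<in>S. c i * q (v i) w)"
proof -
  have lin: "q (\<lambda>f. a * u f + b * z f) w = a * q u w + b * q z w"
    if "u \<in> tangent_space A p" "z \<in> tangent_space A p" for a b u z
    using ip w that unfolding inner_product_on_def by simp
  show ?thesis
    using \<open>finite S\<close> v
  proof (induction S)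
    case empty
    then show ?case using lin[OF w w, of 0 0] by simp
  next
    case (insert j S)
    have "(\<lambda>f. \<Sum>i\<in>S. c i * v i f) \<in> tangent_space A p"
      using insert.hyps insert.prems by (intro tangent_space_sum) auto
    then have "q (\<lambda>f. c j * v j f + 1 * (\<Sum>i\<in>S. c i * v i f)) w
        = c j * q (v j) w + 1 * q (\<lambda>f. \<Sum>i\<in>S. c i * v i f) w"
      by (rule lin[rotated]) (simp add: insert.prems)
    then show ?case using insert by simp
  qed
qed

lemma lin_comb_tangent:
  assumes "orthonormal_basis A m X"
  shows "lin_comb X w p \<in> tangent_space A p"
proof -
  have "X i p \<in> tangent_space A p" for i
    using assms unfolding orthonormal_basis_def lie_algebra_def smooth_vfield_def by blast
  then show ?thesis
    unfolding lin_comb_def by (intro tangent_space_sum) simp_all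
qed

lemma linner_lin_comb:
  assumes m: "bi_invariant_metric A m" and X: "orthonormal_basis A m X"
  shows "linner m (lin_comb X v) (lin_comb X w) = v \<bullet> w"
proof -
  have ip: "inner_product_on (tangent_space A 0) (m 0)"
    using m unfolding bi_invariant_metric_def riemannian_metric_def by blast
  have Xi: "X i 0 \<in> tangent_space A 0" for i
    using X unfolding orthonormal_basis_def lie_algebra_def smooth_vfield_def by blast
  have on: "m 0 (X i 0) (X j 0) = (if i = j then 1 else 0)" for i j
    using X unfolding orthonormal_basis_def linner_def by blast
  have left: "m 0 (lin_comb X u 0) z = (\<Sum>i\<in>UNIV. u $ i * m 0 (X i 0) z)"
    if "z \<in> tangent_space A 0" for u z
    unfolding lin_comb_def by (rule inner_product_on_sum_left[OF ip _ _ that]) (simp_all add: Xi)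
  have sym: "m 0 u z = m 0 z u" if "u \<in> tangent_space A 0" "z \<in> tangent_space A 0" for u z
    using ip that unfolding inner_product_on_def by blast
  have "m 0 (X i 0) (lin_comb X w 0) = w $ i" for i
  proof -
    have "m 0 (X i 0) (lin_comb X w 0) = (\<Sum>j\<in>UNIV. w $ j * m 0 (X j 0) (X i 0))"
      using sym[OF Xi lin_comb_tangent[OF X]] left[OF Xi] by simp
    then show ?thesis by (simp add: on if_distrib cong: if_cong)
  qed
  then show ?thesis
    unfolding linner_def by (simp add: left lin_comb_tangent[OF X] inner_vec_def)
qed

lemma coords_lin_comb:
  assumes "bi_invariant_metric A m" "orthonormal_basis A m X"
  shows "coords m X (lin_comb X w) = w"
proof -
  have "X i = lin_comb X (axis i 1)" for i
  proof (intro ext)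
    fix p f
    have "lin_comb X (axis i 1) p f = (\<Sum>j\<in>UNIV. if j = i then X j p f else 0)"
      unfolding lin_comb_def by (rule sum.cong) (auto simp: axis_def)
    then show "X i p f = lin_comb X (axis i 1) p f" by simp
  qed
  note basis = this
  have "linner m (lin_comb X w) (X i) = w $ i" for i
    by (subst basis) (simp only: linner_lin_comb[OF assms] cart_eq_inner_axis)
  then show ?thesis by (simp add: coords_def vec_eq_iff)
qed

lemma lin_comb_coords:
  assumes "bi_invariant_metric A m" "orthonormal_basis A m X" "Y \<in> lie_algebra A"
  shows "lin_comb X (coords m X Y) = Y"
proof -
  obtain w where "Y = lin_comb X w"
    using assms(2,3) unfolding orthonormal_basis_def by blast
  then show ?thesis by (simp add: coords_lin_comb[OF assms(1,2)])
qed

lemma linner_eq_inner_coords: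
  assumes "bi_invariant_metric A m" "orthonormal_basis A m X"
    "Y \<in> lie_algebra A" "Z \<in> lie_algebra A"
  shows "linner m Y Z = coords m X Y \<bullet> coords m X Z"
  using linner_lin_comb[OF assms(1,2), of "coords m X Y" "coords m X Z"]
  by (simp add: lin_comb_coords[OF assms(1,2)] assms(3,4))

lemma lin_comb_scaleR: "lin_comb X (c *\<^sub>R w) = (\<lambda>p f. c * lin_comb X w p f)"
  by (simp add: lin_comb_def sum_distrib_left mult.assoc)


section \<open>Curves on an interval\<close>

lemma interval_at_within_nontrivial:
  fixes I :: "real set"
  assumes "is_interval I" "interior I \<noteq> {}" "s \<in> I"
  shows "at s within I \<noteq> bot"
proof -
  have "I \<noteq> {x}" for x
    using assms(2) by auto
  then show ?thesis
    using connected_imp_perfect[of I s] assms is_interval_connected trivial_limit_within by blast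
qed

lemma smooth_on_interval:
  fixes f :: "real \<Rightarrow> 'b::real_normed_vector"
  assumes "smooth_on I f" and I: "is_interval I" "interior I \<noteq> {}"
  shows smooth_on_has_vector_derivative:
      "\<And>s. s \<in> I \<Longrightarrow> (f has_vector_derivative vector_derivative f (at s within I)) (at s within I)"
    and smooth_on_continuous_vector_derivative:
      "continuous_on I (\<lambda>s. vector_derivative f (at s within I))"
proof -
  have C1: "Ck_on (Suc 0) I f"
    using assms(1) unfolding smooth_on_def by blast
  then have diff: "f differentiable (at s within I)" if "s \<in> I" for s
    using that by (simp add: differentiable_on_def)
  then show deriv: "(f has_vector_derivative vector_derivative f (at s within I)) (at s within I)"
    if "s \<in> I" for s
    using that vector_derivative_works by blast
  have "vector_derivative f (at s within I) = frechet_derivative f (at s within I) 1"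
    if "s \<in> I" for s
  proof (rule vector_derivative_within[OF interval_at_within_nontrivial[OF I that]])
    have D: "(f has_derivative frechet_derivative f (at s within I)) (at s within I)"
      using diff[OF that] frechet_derivative_works by blast
    have "x *\<^sub>R frechet_derivative f (at s within I) 1 = frechet_derivative f (at s within I) x" for x
      using linear_scale[OF has_derivative_linear[OF D], of x 1] by simp
    then show "(f has_vector_derivative frechet_derivative f (at s within I) 1) (at s within I)"
      unfolding has_vector_derivative_def by (simp add: D)
  qed
  note eq = this
  have "continuous_on I (\<lambda>s. frechet_derivative f (at s within I) 1)"
    using C1 by simp
  then show "continuous_on I (\<lambda>s. vector_derivative f (at s within I))"
    by (rule continuous_on_eq) (simp add: eq)
qed

lemma inner_const_derivative:
  fixes f g :: "real \<Rightarrow> 'a::real_inner"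
  assumes "at s within I \<noteq> bot" "s \<in> I"
    and f: "(f has_vector_derivative f') (at s within I)"
    and g: "(g has_vector_derivative g') (at s within I)"
    and c: "\<And>r. r \<in> I \<Longrightarrow> f r \<bullet> g r = c"
  shows "f s \<bullet> g' + f' \<bullet> g s = 0"
proof (rule vector_derivative_unique_within[OF assms(1)])
  show "((\<lambda>r. f r \<bullet> g r) has_vector_derivative f s \<bullet> g' + f' \<bullet> g s) (at s within I)"
    by (rule bounded_bilinear.has_vector_derivative[OF bounded_bilinear_inner f g])
  show "((\<lambda>r. f r \<bullet> g r) has_vector_derivative 0) (at s within I)"
    by (rule has_vector_derivative_transform[OF \<open>s \<in> I\<close> _ has_vector_derivative_const[of c]])
      (simp add: c)
qed

lemma orthogonal_to_frame_imp_parallel: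
  assumes "t \<bullet> t = 1" "n \<bullet> n = 1" "t \<bullet> n = 0" "v \<bullet> t = 0" "v \<bullet> cross3 t n = 0"
  shows "v = (v \<bullet> n) *\<^sub>R n"
proof -
  have "cross3 (cross3 t n) t = n"
    using Lagrange[of t t n] cross_skew[of "cross3 t n" t] assms by simp
  then have "cross3 v n = 0"
    using Lagrange[of v "cross3 t n" t] assms by simp
  then show ?thesis
    using Lagrange[of n v n] assms by (simp add: inner_commute)
qed

text \<open>
  The component of \<open>b'\<close> along \<open>b\<close> vanishes since \<open>b\<close> has constant length. The component along \<open>t\<close>
  is \<open>- b \<bullet> t'\<close>, and this vanishes because \<open>t'\<close> is a multiple of \<open>n\<close>.
\<close>

lemma binormal_derivative_parallel:
  fixes t n b :: "real \<Rightarrow> real^3"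
  assumes nb: "at s within I \<noteq> bot" and s: "s \<in> I"
    and frame: "\<And>r. r \<in> I \<Longrightarrow> t r \<bullet> t r = 1 \<and> n r \<bullet> n r = 1 \<and> t r \<bullet> n r = 0 \<and> b r = cross3 (t r) (n r)"
    and t: "(t has_vector_derivative k *\<^sub>R n s) (at s within I)"
    and b: "(b has_vector_derivative b') (at s within I)"
  shows "b' = (b' \<bullet> n s) *\<^sub>R n s"
proof (rule orthogonal_to_frame_imp_parallel[of "t s"])
  show "t s \<bullet> t s = 1" "n s \<bullet> n s = 1" "t s \<bullet> n s = 0"
    using frame[OF s] by auto
  have "b r \<bullet> t r = 0" if "r \<in> I" for r
    using frame[OF that] by (simp add: dot_cross_self inner_commute)
  then have "b s \<bullet> (k *\<^sub>R n s) + b' \<bullet> t s = 0"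
    by (rule inner_const_derivative[OF nb s b t])
  then show "b' \<bullet> t s = 0"
    using frame[OF s] by (simp add: dot_cross_self)
  have "b r \<bullet> b r = 1" if "r \<in> I" for r
    using frame[OF that] by (simp add: dot_cross)
  then have "b s \<bullet> b' + b' \<bullet> b s = 0"
    by (rule inner_const_derivative[OF nb s b b])
  then show "b' \<bullet> cross3 (t s) (n s) = 0"
    using frame[OF s] by (simp add: inner_commute)
qed

lemma has_positive_derivative_imp_inj_on:
  fixes \<sigma> :: "real \<Rightarrow> real"
  assumes "is_interval I"
    and \<sigma>: "\<And>s. s \<in> I \<Longrightarrow> (\<sigma> has_real_derivative v s) (at s within I)" "\<And>s. s \<in> I \<Longrightarrow> 0 < v s"
  shows "inj_on \<sigma> I"
proof (rule linorder_inj_onI')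
  fix x y assume xy: "x \<in> I" "y \<in> I" "x < y"
  then have sub: "{x..y} \<subseteq> I"
    using assms(1) by (meson atLeastAtMost_iff mem_is_interval_1_I subsetI)
  have "(\<sigma> has_derivative (*) (v r)) (at r within {x..y})" if "x \<le> r" "r \<le> y" for r
    using \<sigma>(1)[of r] sub that has_derivative_subset
    unfolding has_field_derivative_def by (metis atLeastAtMost_iff subsetD)
  then obtain r where "r \<in> {x<..<y}" "\<sigma> y - \<sigma> x = v r * (y - x)"
    using mvt_simple[OF xy(3), of \<sigma> "\<lambda>r. (*) (v r)"] by blast
  moreover from this sub have "r \<in> I" by auto
  ultimately have "0 < \<sigma> y - \<sigma> x"
    using \<sigma>(2) xy(3) by simp
  then show "\<sigma> x \<noteq> \<sigma> y" by simp
qed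

text \<open>
  The chain rule for \<open>d = b \<circ> \<sigma>\<^sup>-\<^sup>1\<close>. The interval may contain end points, so all derivatives are
  one-sided there; continuity of \<open>\<sigma>\<^sup>-\<^sup>1\<close> comes from the fact that a continuous injection of an
  interval into the line is a homeomorphism onto its image.
\<close>

lemma vector_derivative_reparametrization:
  fixes \<sigma> :: "real \<Rightarrow> real" and b d :: "real \<Rightarrow> 'a::real_normed_vector"
  assumes I: "is_interval I" "interior I \<noteq> {}" and s: "s \<in> I"
    and \<sigma>: "\<And>s. s \<in> I \<Longrightarrow> (\<sigma> has_real_derivative v s) (at s within I)"
    and v: "\<And>s. s \<in> I \<Longrightarrow> 0 < v s"
    and b: "(b has_vector_derivative b') (at s within I)"
    and d: "\<And>s. s \<in> I \<Longrightarrow> d (\<sigma> s) = b s"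
  shows "vector_derivative d (at (\<sigma> s) within \<sigma> ` I) = inverse (v s) *\<^sub>R b'"
proof (rule vector_derivative_within)
  have inj: "inj_on \<sigma> I"
    by (rule has_positive_derivative_imp_inj_on[OF I(1) \<sigma> v])
  have cont: "continuous_on I \<sigma>"
    using \<sigma> DERIV_continuous_on by blast
  have "path_connected I"
    using I(1) is_interval_path_connected by blast
  then obtain g where g: "homeomorphism I (\<sigma> ` I) \<sigma> g"
    using homeomorphism_into_1d[OF _ cont refl inj] by blast
  then have g\<sigma>: "g (\<sigma> r) = r" if "r \<in> I" for r
    using that unfolding homeomorphism_def by blast
  have gcont: "continuous (at (\<sigma> s) within \<sigma> ` I) g"
    using g s unfolding homeomorphism_def continuous_on_eq_continuous_within by blast
  have gim: "g ` \<sigma> ` I = I"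
    using g unfolding homeomorphism_def by blast
  have "(g has_derivative (*) (inverse (v s))) (at (\<sigma> s) within \<sigma> ` I)"
  proof (rule has_derivative_inverse_within[OF _ gcont s])
    show "(\<sigma> has_derivative (*) (v s)) (at s within I)"
      using \<sigma>[OF s] unfolding has_field_derivative_def .
    show "linear ((*) (inverse (v s)))"
      by (simp add: bounded_linear.linear bounded_linear_mult_right)
    show "(*) (inverse (v s)) \<circ> (*) (v s) = id"
      using v[OF s] by (auto simp: fun_eq_iff)
  qed (rule g\<sigma>)
  then have "(g has_vector_derivative inverse (v s)) (at (\<sigma> s) within \<sigma> ` I)"
    by (simp add: has_vector_derivative_def mult_commute_abs)
  moreover have "(b has_vector_derivative b') (at (g (\<sigma> s)) within g ` \<sigma> ` I)"
    using b by (simp add: g\<sigma>[OF s] gim)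
  ultimately have "(b \<circ> g has_vector_derivative inverse (v s) *\<^sub>R b') (at (\<sigma> s) within \<sigma> ` I)"
    by (rule vector_diff_chain_within)
  then show "(d has_vector_derivative inverse (v s) *\<^sub>R b') (at (\<sigma> s) within \<sigma> ` I)"
    by (rule has_vector_derivative_transform[rotated 2]) (use s d g\<sigma> in auto)
  have "\<sigma> ` I \<noteq> {x}" for x
  proof
    assume "\<sigma> ` I = {x}"
    then have "\<sigma> r = x" if "r \<in> I" for r
      using imageI[OF that, of \<sigma>] by simp
    then have "\<sigma> r = \<sigma> s" if "r \<in> I" for r
      using that s by simp
    then have "r = s" if "r \<in> I" for r
      using inj_onD[OF inj _ that s] that by blast
    then have "I = {s}"
      using s by blast
    with I(2) show False by simp
  qed
  moreover have "connected (\<sigma> ` I)"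
    using connected_continuous_image[OF cont] I(1) is_interval_connected by blast
  ultimately show "at (\<sigma> s) within \<sigma> ` I \<noteq> bot"
    using connected_imp_perfect s trivial_limit_within by blast
qed

lemma sgn_constant_on_connected:
  fixes \<mu> :: "'a::topological_space \<Rightarrow> real"
  assumes "connected S" "continuous_on S \<mu>" "\<And>s. s \<in> S \<Longrightarrow> \<mu> s \<noteq> 0"
  obtains \<epsilon> where "\<epsilon> = 1 \<or> \<epsilon> = -1" "\<And>s. s \<in> S \<Longrightarrow> sgn (\<mu> s) = \<epsilon>"
proof -
  have "continuous_on S (\<lambda>s. sgn (\<mu> s))"
    using assms by (intro continuous_on_sgn) auto
  moreover have "(\<lambda>s. sgn (\<mu> s)) ` S \<subseteq> {-1, 0, 1}"
    by (auto simp: sgn_real_def)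
  then have "finite ((\<lambda>s. sgn (\<mu> s)) ` S)"
    by (rule finite_subset) simp
  ultimately have "(\<lambda>s. sgn (\<mu> s)) constant_on S"
    using continuous_finite_range_constant[OF assms(1)] by blast
  then obtain c where c: "\<And>s. s \<in> S \<Longrightarrow> sgn (\<mu> s) = c"
    unfolding constant_on_def by blast
  show thesis
  proof (cases "S = {}")
    case True
    then show ?thesis using that[of 1] by simp
  next
    case False
    then obtain s where "s \<in> S" by blast
    then have "c = 1 \<or> c = -1"
      using c[of s] assms(3)[of s] by (auto simp: sgn_real_def split: if_splits)
    then show ?thesis using that c by blast
  qed
qed


section \<open>The tangent of the binormal indicatrix\<close>

text \<open>The two derivatives differ by \<open>[T, T] / 2\<close>, which vanishes.\<close>

lemma dot_field_eq_cov_deriv: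
  "dot_field m X I T s = cov_deriv m X I T T s"
  by (simp add: cov_deriv_def lie_bracket_def)

text \<open>
  The speed of \<open>b\<close> is \<open>\<bar>\<mu>\<bar>\<close> for the function \<open>\<mu>\<close> with \<open>b' = \<mu> n\<close>, so dividing \<open>b'\<close> by the speed
  leaves \<open>n\<close> with the sign of \<open>\<mu>\<close>.
\<close>

proposition indicatrix_tangent:
  assumes m: "bi_invariant_metric A m" and X: "orthonormal_basis A m X"
    and \<alpha>: "unit_speed_curve A m I \<alpha>"
    and F: "frenet_apparatus A m X I \<alpha> T N B \<kappa> \<tau>"
    and \<delta>: "binormal_indicatrix m X I B \<sigma> \<delta>"
  obtains \<epsilon> where "\<epsilon> = 1 \<or> \<epsilon> = -1"
    "\<And>s. s \<in> I \<Longrightarrow> dot_field m X (\<sigma> ` I) \<delta> (\<sigma> s) = (\<lambda>p f. \<epsilon> * N s p f)"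
proof -
  have I: "is_interval I" "interior I \<noteq> {}"
    using \<alpha> unfolding unit_speed_curve_def by auto
  define t n b where "t s = coords m X (T s)" and "n s = coords m X (N s)"
    and "b s = coords m X (B s)" for s
  define t' b' where "t' s = vector_derivative t (at s within I)"
    and "b' s = vector_derivative b (at s within I)" for s
  note c = coords_lin_comb[OF m X]
  have lie: "T s \<in> lie_algebra A" "N s \<in> lie_algebra A" if "s \<in> I" for s
    using F that unfolding frenet_apparatus_def smooth_field_on_def by auto
  have Nn: "N s = lin_comb X (n s)" if "s \<in> I" for s
    using lin_comb_coords[OF m X lie(2)[OF that]] by (simp add: n_def)
  have smooth: "smooth_on I t" "smooth_on I b"
    using F unfolding frenet_apparatus_def smooth_field_on_def t_def b_def by auto
  note t_deriv = smooth_on_has_vector_derivative[OF smooth(1) I, folded t'_def]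
    and b_deriv = smooth_on_has_vector_derivative[OF smooth(2) I, folded b'_def]
  have dotT: "dot_field m X I T s = lin_comb X (t' s)"
    and dotB: "dot_field m X I B s = lin_comb X (b' s)" for s
    by (simp_all add: dot_field_def t'_def b'_def t_def[abs_def] b_def[abs_def])
  have frame: "t s \<bullet> t s = 1 \<and> n s \<bullet> n s = 1 \<and> t s \<bullet> n s = 0 \<and> b s = cross3 (t s) (n s)"
    if "s \<in> I" for s
  proof -
    have "lnorm m (T s) = 1" "lnorm m (N s) = 1" "linner m (T s) (N s) = 0"
      "B s = cross_field m X (T s) (N s)"
      using F that unfolding frenet_apparatus_def by auto
    then show ?thesis
      using lie[OF that]
      by (simp add: lnorm_def linner_eq_inner_coords[OF m X] cross_field_def b_def c t_def n_def)
  qed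
  have t'_eq: "t' s = \<kappa> s *\<^sub>R n s" if "s \<in> I" for s
  proof -
    have "lin_comb X (t' s) = (\<lambda>p f. \<kappa> s * N s p f)"
      using F that dot_field_eq_cov_deriv[of m X I T s] unfolding frenet_apparatus_def dotT by auto
    then have "lin_comb X (t' s) = lin_comb X (\<kappa> s *\<^sub>R n s)"
      by (simp add: lin_comb_scaleR Nn[OF that])
    then show ?thesis by (metis c)
  qed
  define \<mu> where "\<mu> s = b' s \<bullet> n s" for s
  have b'_eq: "b' s = \<mu> s *\<^sub>R n s" if "s \<in> I" for s
    unfolding \<mu>_def
    by (rule binormal_derivative_parallel[OF interval_at_within_nontrivial[OF I that] that frame])
      (use t_deriv b_deriv t'_eq that in auto)
  have speed: "lnorm m (dot_field m X I B s) = \<bar>\<mu> s\<bar>" if "s \<in> I" for s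
    using frame[OF that]
    by (simp add: lnorm_def dotB linner_lin_comb[OF m X] b'_eq[OF that] flip: power2_eq_square)
  have ind: "0 < \<bar>\<mu> s\<bar>" "(\<sigma> has_real_derivative \<bar>\<mu> s\<bar>) (at s within I)" "\<delta> (\<sigma> s) = B s"
    if "s \<in> I" for s
    using \<delta> that unfolding binormal_indicatrix_def by (auto simp: speed)
  have "continuous_on I n"
  proof -
    have "Ck_on 0 I (\<lambda>s. coords m X (N s))"
      using F unfolding frenet_apparatus_def smooth_field_on_def smooth_on_def by blast
    then show ?thesis by (simp add: n_def[abs_def])
  qed
  then have "continuous_on I \<mu>"
    unfolding \<mu>_def b'_def
    by (intro continuous_on_inner smooth_on_continuous_vector_derivative[OF smooth(2) I])
  then obtain \<epsilon> where \<epsilon>: "\<epsilon> = 1 \<or> \<epsilon> = -1" "\<And>s. s \<in> I \<Longrightarrow> sgn (\<mu> s) = \<epsilon>"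
    using sgn_constant_on_connected[of I \<mu>] is_interval_connected[OF I(1)] ind(1) by auto
  have "dot_field m X (\<sigma> ` I) \<delta> (\<sigma> s) = (\<lambda>p f. \<epsilon> * N s p f)" if s: "s \<in> I" for s
  proof -
    have "vector_derivative (\<lambda>r. coords m X (\<delta> r)) (at (\<sigma> s) within \<sigma> ` I) = inverse \<bar>\<mu> s\<bar> *\<^sub>R b' s"
      by (rule vector_derivative_reparametrization[where b = b, OF I s ind(2) ind(1) b_deriv[OF s]])
        (simp_all add: ind(3) b_def)
    also have "\<dots> = sgn (\<mu> s) *\<^sub>R n s"
      using b'_eq[OF s] ind(1)[OF s] by (simp add: sgn_real_def)
    finally show ?thesis
      by (simp add: dot_field_def \<epsilon>(2)[OF s] lin_comb_scaleR Nn[OF s])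
  qed
  with \<epsilon>(1) show thesis using that by blast
qed


section \<open>Constant angles\<close>

text \<open>
  If the sign is negative, the angle \<open>\<theta>\<close> becomes \<open>\<pi> - \<theta>\<close>. This reflection of \<open>[0, \<pi>]\<close> fixes only the
  right angle, so that the exclusion of \<open>\<pi>/2\<close> has the same meaning on both sides.
\<close>

lemma constant_angle_iff_of_sign:
  assumes \<epsilon>: "\<epsilon> = 1 \<or> \<epsilon> = -1"
    and VW: "\<And>s Y. s \<in> I \<Longrightarrow> Y \<in> lie_algebra A \<Longrightarrow> linner m (W (\<sigma> s)) Y = \<epsilon> * linner m (V s) Y"
  shows "constant_angle A m I V \<longleftrightarrow> constant_angle A m (\<sigma> ` I) W"
proof -
  define \<phi> where "\<phi> \<theta> = (if \<epsilon> = 1 then \<theta> else pi - \<theta>)" for \<theta>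
  have \<phi>: "\<phi> \<theta> \<in> {0..pi} \<and> \<phi> \<theta> \<noteq> pi / 2 \<and> cos (\<phi> \<theta>) = \<epsilon> * cos \<theta>"
    if "\<theta> \<in> {0..pi}" "\<theta> \<noteq> pi / 2" for \<theta>
    using that \<epsilon> by (auto simp: \<phi>_def)
  have \<epsilon>\<epsilon>: "\<epsilon> * (\<epsilon> * x) = x" for x
    using \<epsilon> by auto
  show ?thesis
    unfolding constant_angle_def
  proof (rule bex_cong[OF refl], rule conj_cong[OF refl], rule iffI)
    fix Y assume Y: "Y \<in> lie_algebra A"
    {
      assume "\<exists>\<theta>\<in>{0..pi}. \<theta> \<noteq> pi / 2 \<and> (\<forall>s\<in>I. linner m (V s) Y = cos \<theta>)"
      then obtain \<theta> where "\<theta> \<in> {0..pi}" "\<theta> \<noteq> pi / 2" "\<forall>s\<in>I. linner m (V s) Y = cos \<theta>"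
        by blast
      then show "\<exists>\<theta>\<in>{0..pi}. \<theta> \<noteq> pi / 2 \<and> (\<forall>r\<in>\<sigma> ` I. linner m (W r) Y = cos \<theta>)"
        using \<phi>[of \<theta>] VW[OF _ Y] by (intro bexI[of _ "\<phi> \<theta>"]) auto
    next
      assume "\<exists>\<theta>\<in>{0..pi}. \<theta> \<noteq> pi / 2 \<and> (\<forall>r\<in>\<sigma> ` I. linner m (W r) Y = cos \<theta>)"
      then obtain \<theta> where \<theta>: "\<theta> \<in> {0..pi}" "\<theta> \<noteq> pi / 2" "\<forall>r\<in>\<sigma> ` I. linner m (W r) Y = cos \<theta>"
        by blast
      have "linner m (V s) Y = \<epsilon> * cos \<theta>" if "s \<in> I" for s
        using VW[OF that Y] \<theta>(3) that \<epsilon>\<epsilon>[of "linner m (V s) Y"] by auto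
      then show "\<exists>\<theta>\<in>{0..pi}. \<theta> \<noteq> pi / 2 \<and> (\<forall>s\<in>I. linner m (V s) Y = cos \<theta>)"
        using \<phi>[of \<theta>] \<theta> by (intro bexI[of _ "\<phi> \<theta>"]) auto
    }
  qed
qed

theorem theorem4p7:
  fixes A :: "'g::{topological_group_add, t2_space, second_countable_topology} atlas"
    and m :: "'g metric"
    and X :: "3 \<Rightarrow> 'g vfield"
    and I :: "real set" and \<alpha> :: "real \<Rightarrow> 'g"
    and T N B \<delta> :: "real \<Rightarrow> 'g vfield"
    and \<kappa> \<tau> \<sigma> :: "real \<Rightarrow> real"
  assumes "lie_group_3 A"
    and "bi_invariant_metric A m"
    and "orthonormal_basis A m X"
    and "unit_speed_curve A m I \<alpha>"
    and "frenet_apparatus A m X I \<alpha> T N B \<kappa> \<tau>"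
    and "binormal_indicatrix m X I B \<sigma> \<delta>"
  shows "slant_helix A m I N \<longleftrightarrow> general_helix A m X (\<sigma> ` I) \<delta>"
proof -
  obtain \<epsilon> where \<epsilon>: "\<epsilon> = 1 \<or> \<epsilon> = -1"
    and tangent: "\<And>s. s \<in> I \<Longrightarrow> dot_field m X (\<sigma> ` I) \<delta> (\<sigma> s) = (\<lambda>p f. \<epsilon> * N s p f)"
    using indicatrix_tangent[OF assms(2-6)] by blast
  have "linner m (dot_field m X (\<sigma> ` I) \<delta> (\<sigma> s)) Y = \<epsilon> * linner m (N s) Y"
    if s: "s \<in> I" and Y: "Y \<in> lie_algebra A" for s Y
  proof -
    have N: "N s \<in> lie_algebra A"
      using assms(5) s unfolding frenet_apparatus_def smooth_field_on_def by blast
    note coords = lin_comb_coords[OF assms(2,3)]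
    have "linner m (\<lambda>p f. \<epsilon> * N s p f) Y
        = linner m (lin_comb X (\<epsilon> *\<^sub>R coords m X (N s))) (lin_comb X (coords m X Y))"
      by (simp add: lin_comb_scaleR coords N Y)
    also have "\<dots> = \<epsilon> * linner m (N s) Y"
      by (simp add: linner_lin_comb[OF assms(2,3)] linner_eq_inner_coords[OF assms(2,3) N Y])
    finally show ?thesis by (simp add: tangent[OF s])
  qed
  then show ?thesis
    unfolding slant_helix_def general_helix_def by (rule constant_angle_iff_of_sign[OF \<epsilon>])
qed

end
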